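(* Fix any distribution $\mathcal{D}$ of a non-negative random variable $D$ with finite mean and strictly positive variance. Then the function $\varrho\mapsto\gamma(\varrho)$ defined in the context is non-decreasing in $\varrho\in(0,\infty)$.
   Context: Let $\{D_i\}_{i\ge1}$ be i.i.d. with distribution $\mathcal{D}$, and let $h,p>0$ (unit holding cost and unit lost-sales penalty). For $r\in[0,\mathbb{E}[D])$ let $$C(\pi_r)=h\,\mathbb{E}\Big[\sup_{j\ge0}\Big(jr-\sum_{i=1}^jD_i\Big)\Big]+p\,\mathbb{E}[D]-pr$$ (the long-run average cost of ordering the constant $r$ every period in a lost-sales inventory system); it is finite and convex on $[0,\mathbb{E}[D])$ and tends to $\infty$ as $r\uparrow\mathbb{E}[D]$ (set it to $+\infty$ at $r=\mathbb{E}[D]$). Empty sums equal $0$. Let $r_\infty$ be the infimum of the set of minimizers of $r\mapsto C(\pi_r)$ over $[0,\mathbb{E}[D]]$. Let $$\gamma=\inf_{\theta\ge0}\exp(\theta r_\infty)\,\mathbb{E}[\exp(-\theta D)].$$ For fixed $\mathcal{D}$, $r_\infty$ and hence $\gamma$ depend on $(p,h)$ only through the ratio $p/h$; $\gamma(\varrho)$ denotes the value of $\gamma$ when $p/h=\varrho$. *)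

theory Defs
  imports "HOL-Probability.Probability"
begin

text \<open>
  The demands are random variables \<open>D 1, D 2, \<dots>\<close> on a probability space \<open>M\<close> (the value \<open>D 0\<close> is
  never used), and \<open>\<D>\<close> is their common law.
\<close>

definition iid_with_law :: "'a measure \<Rightarrow> (nat \<Rightarrow> 'a \<Rightarrow> real) \<Rightarrow> real measure \<Rightarrow> bool" where
  "iid_with_law M D \<D> \<longleftrightarrow>
     prob_space M \<and>
     prob_space.indep_vars M (\<lambda>_. borel) D {1..} \<and>
     (\<forall>i\<ge>1. distr M borel (D i) = \<D>)"

definition law_mean :: "real measure \<Rightarrow> real" where
  "law_mean \<D> = (\<integral>x. x \<partial>\<D>)"

text \<open>
  The variance is extended-valued: a law with finite mean may have infinite variance, which
  the Bochner integral would report as \<open>0\<close>.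
\<close>

definition law_variance :: "real measure \<Rightarrow> ennreal" where
  "law_variance \<D> = (\<integral>\<^sup>+x. ennreal ((x - law_mean \<D>)\<^sup>2) \<partial>\<D>)"

text \<open>
  The supremum and its expectation are taken in the extended reals, so no finiteness is
  presupposed. The term \<open>j = 0\<close> makes the supremum non-negative, so \<open>e2ennreal\<close> truncates nothing.
\<close>

definition expected_sup :: "'a measure \<Rightarrow> (nat \<Rightarrow> 'a \<Rightarrow> real) \<Rightarrow> real \<Rightarrow> ennreal" where
  "expected_sup M D r =
     (\<integral>\<^sup>+\<omega>. e2ennreal (SUP j. ereal (real j * r - (\<Sum>i=1..j. D i \<omega>))) \<partial>M)"

definition cost ::
  "'a measure \<Rightarrow> (nat \<Rightarrow> 'a \<Rightarrow> real) \<Rightarrow> real measure \<Rightarrow> real \<Rightarrow> real \<Rightarrow> real \<Rightarrow> ereal" where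
  "cost M D \<D> h p r =
     (if r < law_mean \<D>
      then ereal h * enn2ereal (expected_sup M D r) + ereal (p * law_mean \<D> - p * r)
      else \<infinity>)"

definition minimizers ::
  "'a measure \<Rightarrow> (nat \<Rightarrow> 'a \<Rightarrow> real) \<Rightarrow> real measure \<Rightarrow> real \<Rightarrow> real \<Rightarrow> real set" where
  "minimizers M D \<D> h p =
     {r \<in> {0..law_mean \<D>}. \<forall>s \<in> {0..law_mean \<D>}. cost M D \<D> h p r \<le> cost M D \<D> h p s}"

definition r_inf ::
  "'a measure \<Rightarrow> (nat \<Rightarrow> 'a \<Rightarrow> real) \<Rightarrow> real measure \<Rightarrow> real \<Rightarrow> real \<Rightarrow> real" where
  "r_inf M D \<D> h p = Inf (minimizers M D \<D> h p)"

definition gamma ::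
  "'a measure \<Rightarrow> (nat \<Rightarrow> 'a \<Rightarrow> real) \<Rightarrow> real measure \<Rightarrow> real \<Rightarrow> real \<Rightarrow> real" where
  "gamma M D \<D> h p =
     (INF \<theta>\<in>{0..}. exp (\<theta> * r_inf M D \<D> h p) * (\<integral>x. exp (- \<theta> * x) \<partial>\<D>))"

text \<open>
  The common value of \<open>gamma\<close> over all \<open>h, p > 0\<close> with \<open>p / h = \<rho>\<close>. The description is
  well defined for \<open>\<rho> > 0\<close>; see \<open>gamma_ratio_eq\<close> below.
\<close>

definition gamma_ratio ::
  "'a measure \<Rightarrow> (nat \<Rightarrow> 'a \<Rightarrow> real) \<Rightarrow> real measure \<Rightarrow> real \<Rightarrow> real" where
  "gamma_ratio M D \<D> \<rho> =
     (THE g. \<forall>h p. 0 < h \<longrightarrow> 0 < p \<longrightarrow> p / h = \<rho> \<longrightarrow> gamma M D \<D> h p = g)"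

lemma cost_scale:
  assumes "0 < h"
  shows "cost M D \<D> h p r = ereal h * cost M D \<D> 1 (p / h) r"
proof -
  have "ereal h * (X + ereal (p / h * a - p / h * r)) = ereal h * X + ereal (p * a - p * r)" for X a
    using assms by (cases X) (auto simp: field_simps)
  then show ?thesis
    using assms by (simp add: cost_def one_ereal_def[symmetric])
qed

lemma gamma_scale:
  assumes "0 < h"
  shows "gamma M D \<D> h p = gamma M D \<D> 1 (p / h)"
proof -
  have "cost M D \<D> h p r \<le> cost M D \<D> h p s
        \<longleftrightarrow> cost M D \<D> 1 (p / h) r \<le> cost M D \<D> 1 (p / h) s" for r s
    unfolding cost_scale[OF assms, of M D \<D> p]
    using assms by (subst ereal_mult_le_mult_iff) auto
  then show ?thesis
    by (simp add: gamma_def r_inf_def minimizers_def)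
qed

lemma gamma_ratio_eq:
  assumes "0 < h" "0 < p"
  shows "gamma_ratio M D \<D> (p / h) = gamma M D \<D> h p"
  unfolding gamma_ratio_def
proof (rule the_equality)
  show "\<forall>h' p'. 0 < h' \<longrightarrow> 0 < p' \<longrightarrow> p' / h' = p / h \<longrightarrow> gamma M D \<D> h' p' = gamma M D \<D> h p"
    using gamma_scale assms by metis
qed (use assms in blast)

end

theory Submission
  imports Defs
begin

text \<open>
  The infimum over \<open>\<theta>\<close> is monotone in \<open>r\<^sub>\<infinity>\<close>, so it is enough that \<open>r\<^sub>\<infinity>\<close> does not decrease
  when \<open>p\<close> grows with \<open>h = 1\<close>. A revealed-preference argument shows that every minimizer for the
  smaller \<open>p\<close> lies below every minimizer for the larger one. For the infima to be comparable,
  minimizers must exist. The expected supremum is lower semicontinuous by Fatou's lemma, so it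
  remains to see that it is infinite at \<open>r = \<mu>\<close>, the mean demand. If it were finite there, the
  supremum \<open>f\<close> of the walk and the supremum \<open>f'\<close> of the walk after its first step would satisfy
  \<open>f \<ge> \<mu> - D\<^sub>1 + f'\<close> with equal means on both sides, hence \<open>f = \<mu> - D\<^sub>1 + f'\<close> almost surely. As
  \<open>D\<^sub>1 \<ge> \<mu> + \<delta>\<close> has positive probability for some \<open>\<delta> > 0\<close> and \<open>f'\<close> is an independent copy of \<open>f\<close>,
  an almost sure lower bound \<open>c\<close> for \<open>f\<close> improves to \<open>c + \<delta>\<close>, so \<open>f\<close> would be infinite.
\<close>

text \<open>
  Demands are indexed from \<open>0\<close> here. Since \<open>ennreal\<close> truncates negative values and the term
  \<open>j = 0\<close> is \<open>0\<close>, the truncation does not change the supremum.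
\<close>

definition walk_sup :: "real \<Rightarrow> (nat \<Rightarrow> real) \<Rightarrow> ennreal" where
  "walk_sup r x = (SUP j. ennreal (real j * r - (\<Sum>i<j. x i)))"

lemma e2ennreal_SUP: "e2ennreal (SUP j::nat. f j) = (SUP j. e2ennreal (f j))"
proof -
  have "e2ennreal (Sup (range f)) = Sup (e2ennreal ` range f)"
    by (rule continuous_at_Sup_mono)
       (auto intro: monoI e2ennreal_mono continuous_at_e2ennreal)
  then show ?thesis by (simp add: image_image)
qed

lemma expected_sup_walk_sup:
  "expected_sup M D r = (\<integral>\<^sup>+\<omega>. walk_sup r (\<lambda>i. D (Suc i) \<omega>) \<partial>M)"
proof -
  have "(\<Sum>i=1..j. D i \<omega>) = (\<Sum>i<j. D (Suc i) \<omega>)" for j \<omega>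
    using sum.shift_bounds_Suc_ivl[of "\<lambda>i. D i \<omega>" 0 j]
    by (simp add: atLeastLessThanSuc_atLeastAtMost lessThan_atLeast0)
  then show ?thesis
    by (simp add: expected_sup_def walk_sup_def e2ennreal_SUP)
qed

lemma walk_sup_upper: "ennreal (real j * r - (\<Sum>i<j. x i)) \<le> walk_sup r x"
  unfolding walk_sup_def by (rule SUP_upper) simp

text \<open>After a first step \<open>r - s\<close> the walk continues as the walk of
  \<open>x\<close>; the supremum on the right merely has the extra starting term
  \<open>j = 0\<close>.\<close>

lemma walk_sup_case_nat:
  assumes "walk_sup r (case_nat s x) < \<top>"
  shows "r - s + enn2real (walk_sup r x) \<le> enn2real (walk_sup r (case_nat s x))"
proof -
  define f where "f = enn2real (walk_sup r (case_nat s x))"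
  have f: "walk_sup r (case_nat s x) = ennreal f" "0 \<le> f"
    using assms by (auto simp: f_def)
  have step: "real j * r - (\<Sum>i<j. x i) \<le> f - r + s" for j
  proof -
    have "(\<Sum>i<Suc j. case_nat s x i) = s + (\<Sum>i<j. x i)"
      by (subst sum.lessThan_Suc_shift) simp
    then have "ennreal (real (Suc j) * r - (s + (\<Sum>i<j. x i))) \<le> ennreal f"
      using walk_sup_upper[of "Suc j" r "case_nat s x"] f by simp
    then have "real (Suc j) * r - (s + (\<Sum>i<j. x i)) \<le> f"
      using f by simp
    then show ?thesis by (simp add: algebra_simps)
  qed
  have "walk_sup r x \<le> ennreal (f - r + s)"
    unfolding walk_sup_def using step by (intro SUP_least ennreal_leI)
  then have "enn2real (walk_sup r x) \<le> f - r + s"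
    \<comment> \<open>The case \<open>j = 0\<close> gives \<open>0 \<le> f - r + s\<close>, so
      \<open>ennreal\<close> truncates nothing in the bound.\<close>
    using step[of 0] by (auto intro: enn2real_leI)
  then show ?thesis by (simp add: f_def)
qed

text \<open>A supremum of functions continuous in \<open>r\<close> is lower semicontinuous.\<close>

lemma walk_sup_le_liminf:
  assumes "r \<longlonglongrightarrow> l"
  shows "walk_sup l x \<le> liminf (\<lambda>n. walk_sup (r n) x)"
proof -
  have "ennreal (real j * l - (\<Sum>i<j. x i)) \<le> liminf (\<lambda>n. walk_sup (r n) x)" for j
  proof -
    have "(\<lambda>n. ennreal (real j * r n - (\<Sum>i<j. x i))) \<longlonglongrightarrow> ennreal (real j * l - (\<Sum>i<j. x i))"
      by (intro tendsto_intros assms)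
    from lim_imp_Liminf[OF sequentially_bot this]
    have "ennreal (real j * l - (\<Sum>i<j. x i)) = liminf (\<lambda>n. ennreal (real j * r n - (\<Sum>i<j. x i)))" ..
    also have "\<dots> \<le> liminf (\<lambda>n. walk_sup (r n) x)"
      by (intro Liminf_mono always_eventually allI walk_sup_upper)
    finally show ?thesis .
  qed
  then show ?thesis unfolding walk_sup_def by (intro SUP_least)
qed

lemma walk_sup_measurable [measurable]:
  assumes "sets N = sets borel"
  shows "walk_sup r \<in> borel_measurable (\<Pi>\<^sub>M i\<in>UNIV. N)"
proof -
  have [measurable]: "(\<lambda>x. x i) \<in> borel_measurable (\<Pi>\<^sub>M i\<in>UNIV. N)" for i :: nat
    using measurable_component_singleton[of i UNIV "\<lambda>_. N"]
    by (subst measurable_cong_sets[OF refl assms[symmetric]]) auto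
  show ?thesis unfolding walk_sup_def by measurable
qed

section \<open>Divergence of the expected supremum at the mean demand\<close>

lemma nn_integral_walk_sup_mean:
  assumes "prob_space N" and sets: "sets N = sets borel"
    and int: "integrable N (\<lambda>x. x)" and nondeg: "\<not> (AE x in N. x = law_mean N)"
  shows "(\<integral>\<^sup>+x. walk_sup (law_mean N) x \<partial>(\<Pi>\<^sub>M i\<in>(UNIV::nat set). N)) = \<top>"
proof (rule ccontr)
  define \<mu> where "\<mu> = law_mean N"
  interpret N: prob_space N by fact
  interpret S: sequence_space N ..
  interpret P: pair_prob_space N S.S ..
  define f where "f x = enn2real (walk_sup \<mu> x)" for x :: "nat \<Rightarrow> real"
  have [measurable]: "walk_sup \<mu> \<in> borel_measurable S.S"
    using walk_sup_measurable[OF sets] .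
  have f_meas [measurable]: "f \<in> borel_measurable S.S"
    unfolding f_def by measurable
  have shift [measurable]: "(\<lambda>(s, \<omega>). case_nat s \<omega>) \<in> N \<Otimes>\<^sub>M S.S \<rightarrow>\<^sub>M S.S"
    by measurable
  have [measurable]: "(\<lambda>x. x) \<in> borel_measurable N"
    using int by (rule borel_measurable_integrable)
  assume "\<not> ?thesis"
  then have fin: "(\<integral>\<^sup>+x. walk_sup \<mu> x \<partial>S.S) < \<top>"
    by (simp add: \<mu>_def less_top)
  then have AE_fin: "AE x in S.S. walk_sup \<mu> x < \<top>"
    using nn_integral_PInf_AE[of "walk_sup \<mu>" S.S] by (auto simp: less_top)
  have f_int: "integrable S.S f"
  proof (rule integrableI_nonneg)
    have "(\<integral>\<^sup>+x. ennreal (f x) \<partial>S.S) = (\<integral>\<^sup>+x. walk_sup \<mu> x \<partial>S.S)"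
      using AE_fin by (intro nn_integral_cong_AE) (auto simp: f_def)
    with fin show "(\<integral>\<^sup>+x. ennreal (f x) \<partial>S.S) < \<infinity>" by simp
  qed (auto simp: f_def)
  \<comment> \<open>Prepending an independent draw preserves the law of an i.i.d. sequence
    (\<open>PiM_iter\<close>), so almost sure properties pull back along
    \<open>case_nat\<close>.\<close>
  have AE_shift: "AE (s, x) in N \<Otimes>\<^sub>M S.S. Q (case_nat s x)"
    if "AE x in S.S. Q x" "Measurable.pred S.S Q" for Q
  proof -
    have "AE x in distr (N \<Otimes>\<^sub>M S.S) S.S (\<lambda>(s, \<omega>). case_nat s \<omega>). Q x"
      unfolding S.PiM_iter by (rule that)
    then have "AE z in N \<Otimes>\<^sub>M S.S. Q (case z of (s, \<omega>) \<Rightarrow> case_nat s \<omega>)"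
      by (subst (asm) AE_distr_iff[OF shift]) (use that(2) in \<open>auto simp: pred_def\<close>)
    then show ?thesis by (simp add: case_prod_unfold)
  qed
  \<comment> \<open>\<open>g\<close> is the slack in \<open>walk_sup_case_nat\<close>: almost surely
    non-negative and, as both copies of \<open>f\<close> have the same mean, of integral
    zero.\<close>
  define g where "g z = f (case z of (s, x) \<Rightarrow> case_nat s x) - (\<mu> - fst z + f (snd z))" for z
  have "AE (s, x) in N \<Otimes>\<^sub>M S.S. walk_sup \<mu> (case_nat s x) < \<top>"
    by (rule AE_shift[OF AE_fin]) measurable
  then have g_nonneg: "AE z in N \<Otimes>\<^sub>M S.S. 0 \<le> g z"
    by (rule eventually_mono) (auto simp: g_def f_def dest: walk_sup_case_nat)
  have i1: "integrable (N \<Otimes>\<^sub>M S.S) (\<lambda>z. f (case z of (s, x) \<Rightarrow> case_nat s x))"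
    using f_int by (subst (asm) S.PiM_iter[symmetric], subst (asm) integrable_distr_eq) auto
  have e1: "(\<integral>z. f (case z of (s, x) \<Rightarrow> case_nat s x) \<partial>(N \<Otimes>\<^sub>M S.S)) = (\<integral>x. f x \<partial>S.S)"
    by (subst (2) S.PiM_iter[symmetric], subst integral_distr) auto
  have marg1: "distr (N \<Otimes>\<^sub>M S.S) N fst = N"
    by (simp add: S.P.distr_pair_fst)
  have marg2: "distr (N \<Otimes>\<^sub>M S.S) S.S snd = S.S"
    using N.distr_pair_fst[of S.S]
    by (subst P.distr_pair_swap, subst distr_distr) (auto simp: comp_def case_prod_unfold)
  have i2: "integrable (N \<Otimes>\<^sub>M S.S) (\<lambda>z. fst z)" 
    using int by (subst (asm) marg1[symmetric], subst (asm) integrable_distr_eq) auto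
  have e2: "(\<integral>z. fst z \<partial>(N \<Otimes>\<^sub>M S.S)) = \<mu>"
    unfolding \<mu>_def law_mean_def by (subst (2) marg1[symmetric], subst integral_distr) auto
  have i3: "integrable (N \<Otimes>\<^sub>M S.S) (\<lambda>z. f (snd z))"
    using f_int by (subst (asm) marg2[symmetric], subst (asm) integrable_distr_eq) auto
  have e3: "(\<integral>z. f (snd z) \<partial>(N \<Otimes>\<^sub>M S.S)) = (\<integral>x. f x \<partial>S.S)"
    by (subst (2) marg2[symmetric], subst integral_distr) auto
  have "integrable (N \<Otimes>\<^sub>M S.S) g" "(\<integral>z. g z \<partial>(N \<Otimes>\<^sub>M S.S)) = 0"
    unfolding g_def using i1 i2 i3 by (auto simp: e1 e2 e3 P.prob_space)
  then have "AE z in N \<Otimes>\<^sub>M S.S. g z = 0"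
    using integral_nonneg_eq_0_iff_AE[of "N \<Otimes>\<^sub>M S.S" g] g_nonneg by blast
  then have recur: "AE (s, x) in N \<Otimes>\<^sub>M S.S. f (case_nat s x) = \<mu> - s + f x"
    by (auto simp: g_def case_prod_unfold)

  have "\<not> (AE s in N. s \<le> \<mu>)"
  proof
    assume le: "AE s in N. s \<le> \<mu>"
    have "(\<integral>s. \<mu> - s \<partial>N) = 0"
      using int by (simp add: \<mu>_def law_mean_def N.prob_space)
    then have "AE s in N. \<mu> - s = 0"
      using le int integral_nonneg_eq_0_iff_AE[of N "\<lambda>s. \<mu> - s"] by auto
    then have "AE s in N. s = law_mean N" by (auto simp: \<mu>_def)
    with nondeg show False ..
  qed
  \<comment> \<open>If no \<open>\<delta>\<close> of the form \<open>1 / Suc n\<close> worked,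
    countably many null sets would combine to the case just excluded.\<close>
  moreover have "AE s in N. s \<le> \<mu>" if "\<And>n. AE s in N. s < \<mu> + 1 / real (Suc n)"
  proof -
    have "AE s in N. \<forall>n. s < \<mu> + 1 / real (Suc n)"
      using that by (subst AE_all_countable) auto
    then show ?thesis
    proof (rule AE_mp, intro AE_I2 impI)
      fix s assume s: "\<forall>n. s < \<mu> + 1 / real (Suc n)"
      show "s \<le> \<mu>"
      proof (rule ccontr)
        assume "\<not> s \<le> \<mu>"
        then obtain n where "1 / real (Suc n) < s - \<mu>"
          using nat_approx_posE[of "s - \<mu>"] by auto
        with s[rule_format, of n] show False by simp
      qed
    qed
  qed
  ultimately obtain \<delta> :: real where \<delta>: "0 < \<delta>" "\<not> (AE s in N. s < \<mu> + \<delta>)"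
    by (metis of_nat_0_less_iff zero_less_Suc zero_less_divide_1_iff)
  have lower: "AE x in S.S. real n * \<delta> \<le> f x" for n
  proof (induction n)
    case 0
    show ?case by (simp add: f_def)
  next
    case (Suc n)
    have "AE (s, x) in N \<Otimes>\<^sub>M S.S. real n * \<delta> \<le> f (case_nat s x)"
      by (rule AE_shift[OF Suc]) measurable
    with recur have "AE (s, x) in N \<Otimes>\<^sub>M S.S. real n * \<delta> \<le> \<mu> - s + f x"
      by eventually_elim auto
    then have "AE s in N. AE x in S.S. real n * \<delta> \<le> \<mu> - s + f x"
      by (auto dest: P.AE_pair)
    \<comment> \<open>The \<open>s\<close> that fail form a null set while
      \<open>s \<ge> \<mu> + \<delta>\<close> is not null, so one good \<open>s\<close> can be
      fixed; it raises the bound on \<open>f\<close> by \<open>\<delta>\<close>.\<close>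
    then have "\<exists>s. \<mu> + \<delta> \<le> s \<and> (AE x in S.S. real n * \<delta> \<le> \<mu> - s + f x)"
      using \<delta>(2) by (metis (mono_tags, lifting) AE_mp AE_I2 not_less)
    then obtain s where "\<mu> + \<delta> \<le> s" "AE x in S.S. real n * \<delta> \<le> \<mu> - s + f x" by blast
    then show ?case by (auto elim!: eventually_mono simp: algebra_simps)
  qed
  then have "AE x in S.S. \<forall>n. real n * \<delta> \<le> f x"
    by (simp add: AE_all_countable)
  moreover have "\<not> (\<forall>n. real n * \<delta> \<le> f x)" for x
    using reals_Archimedean3[OF \<delta>(1)] by (auto simp: not_le)
  ultimately have "AE x in S.S. False" by simp
  then show False
    using S.P.AE_False by simp
qed

section \<open>Transfer to the demand sequence\<close>

text \<open>Independence makes the joint law of the demands a product measure; reindexing along the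
  injection \<open>Suc\<close> moves it to sequences starting at \<open>0\<close>.\<close>

lemma expected_sup_iid:
  assumes "iid_with_law M D \<D>"
  shows "expected_sup M D r = (\<integral>\<^sup>+x. walk_sup r x \<partial>(\<Pi>\<^sub>M i\<in>UNIV. \<D>))"
proof -
  interpret prob_space M using assms by (simp add: iid_with_law_def)
  have ind: "indep_vars (\<lambda>_. borel) D {1..}" and law: "\<And>i. distr M borel (D (Suc i)) = \<D>"
    using assms by (auto simp: iid_with_law_def)
  have rvs: "random_variable borel (D i)" if "i \<in> {1..}" for i
    using ind that by (auto simp: indep_vars_def)
  have rv [measurable]: "random_variable borel (D (Suc i))" for i
    by (rule rvs) simp
  have sets: "sets \<D> = sets borel"
    using law by (metis sets_distr)
  have "distr M (\<Pi>\<^sub>M i\<in>{1..}. borel) (\<lambda>\<omega>. \<lambda>i\<in>{1..}. D i \<omega>)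
      = (\<Pi>\<^sub>M i\<in>{1..}. distr M borel (D i))"
    using ind rvs by (subst (asm) indep_vars_iff_distr_eq_PiM') auto
  also have "\<dots> = (\<Pi>\<^sub>M i\<in>{1..}. \<D>)"
    using assms by (intro PiM_cong) (auto simp: iid_with_law_def)
  finally have joint: "distr M (\<Pi>\<^sub>M i\<in>{1..}. borel) (\<lambda>\<omega>. \<lambda>i\<in>{1..}. D i \<omega>) = (\<Pi>\<^sub>M i\<in>{1..}. \<D>)" .
  have "prob_space \<D>"
    using prob_space_distr[OF rv] law by metis
  then have "(\<Pi>\<^sub>M i\<in>UNIV. \<D>) = distr (\<Pi>\<^sub>M i\<in>{1..}. \<D>) (\<Pi>\<^sub>M i\<in>UNIV. \<D>) (\<lambda>x. \<lambda>n\<in>UNIV. x (Suc n))"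
    by (subst distr_PiM_reindex) auto
  also have "\<dots> = distr (\<Pi>\<^sub>M i\<in>{1..}. \<D>) (\<Pi>\<^sub>M i\<in>UNIV. borel) (\<lambda>x n. x (Suc n))"
    using sets by (intro distr_cong sets_PiM_cong) auto
  also have "\<dots> = distr M (\<Pi>\<^sub>M i\<in>UNIV. borel) (\<lambda>\<omega> i. D (Suc i) \<omega>)"
    unfolding joint[symmetric]
  proof (subst distr_distr)
    show "(\<lambda>x n. x (Suc n)) \<in> (\<Pi>\<^sub>M i\<in>{1::nat..}. borel) \<rightarrow>\<^sub>M (\<Pi>\<^sub>M i\<in>UNIV. (borel :: real measure))"
      by (rule measurable_PiM_single') (auto intro!: measurable_component_singleton)
    show "(\<lambda>\<omega>. \<lambda>i\<in>{1..}. D i \<omega>) \<in> M \<rightarrow>\<^sub>M (\<Pi>\<^sub>M i\<in>{1..}. borel)"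
      by (intro measurable_restrict rvs)
  qed (simp add: comp_def)
  finally have eq: "(\<Pi>\<^sub>M i\<in>UNIV. \<D>) = distr M (\<Pi>\<^sub>M i\<in>UNIV. borel) (\<lambda>\<omega> i. D (Suc i) \<omega>)" .
  have [measurable]: "walk_sup r \<in> borel_measurable (\<Pi>\<^sub>M i\<in>UNIV. borel)"
    by (rule walk_sup_measurable) simp
  have "(\<lambda>\<omega> i. D (Suc i) \<omega>) \<in> M \<rightarrow>\<^sub>M (\<Pi>\<^sub>M i\<in>UNIV. borel)"
    by (rule measurable_PiM_single') auto
  then show ?thesis
    unfolding expected_sup_walk_sup eq by (subst nn_integral_distr) auto
qed

lemma iid_with_law_sets: "iid_with_law M D \<D> \<Longrightarrow> sets \<D> = sets borel"
  by (metis iid_with_law_def order_refl sets_distr)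

lemma iid_with_law_measurable: "iid_with_law M D \<D> \<Longrightarrow> 1 \<le> i \<Longrightarrow> D i \<in> borel_measurable M"
  by (auto simp: iid_with_law_def prob_space.indep_vars_def)

lemma iid_with_law_prob_space:
  assumes "iid_with_law M D \<D>" shows "prob_space \<D>"
  using assms prob_space.prob_space_distr[OF _ iid_with_law_measurable[OF assms order_refl]]
  by (auto simp: iid_with_law_def)

lemma expected_sup_le_liminf:
  assumes "iid_with_law M D \<D>" "r \<longlonglongrightarrow> l"
  shows "expected_sup M D l \<le> liminf (\<lambda>n. expected_sup M D (r n))"
  unfolding expected_sup_iid[OF assms(1)]
  by (rule order_trans[OF nn_integral_mono[OF walk_sup_le_liminf[OF assms(2)]] nn_integral_liminf])
     (rule walk_sup_measurable[OF iid_with_law_sets[OF assms(1)]])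

lemma expected_sup_zero:
  assumes iid: "iid_with_law M D \<D>" and nonneg: "AE x in \<D>. 0 \<le> x"
  shows "expected_sup M D 0 = 0"
proof -
  have "AE \<omega> in M. 0 \<le> D (Suc i) \<omega>" for i
  proof -
    have law: "distr M borel (D (Suc i)) = \<D>"
      using iid by (auto simp: iid_with_law_def)
    have "AE x in distr M borel (D (Suc i)). 0 \<le> x"
      unfolding law by (rule nonneg)
    then show ?thesis
      by (subst (asm) AE_distr_iff[OF iid_with_law_measurable[OF iid]]) auto
  qed
  then have "AE \<omega> in M. \<forall>i. 0 \<le> D (Suc i) \<omega>"
    by (simp add: AE_all_countable)
  then have "AE \<omega> in M. walk_sup 0 (\<lambda>i. D (Suc i) \<omega>) = 0"
    by (rule eventually_mono) (auto simp: walk_sup_def ennreal_neg sum_nonneg)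
  then show ?thesis
    unfolding expected_sup_walk_sup by (subst nn_integral_cong_AE) auto
qed

lemma expected_sup_mean:
  assumes iid: "iid_with_law M D \<D>" and "integrable \<D> (\<lambda>x. x)" "0 < law_variance \<D>"
  shows "expected_sup M D (law_mean \<D>) = \<top>"
proof -
  have "\<not> (AE x in \<D>. x = law_mean \<D>)"
  proof
    assume "AE x in \<D>. x = law_mean \<D>"
    then have "law_variance \<D> = (\<integral>\<^sup>+x. 0 \<partial>\<D>)"
      unfolding law_variance_def by (intro nn_integral_cong_AE) (auto elim: eventually_mono)
    with assms(3) show False by simp
  qed
  then show ?thesis
    unfolding expected_sup_iid[OF iid]
    using nn_integral_walk_sup_mean iid_with_law_prob_space[OF iid] iid_with_law_sets[OF iid] assms(2)
    by blast
qed

section \<open>Existence and monotonicity of minimizers\<close>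

text \<open>Direct method: a minimizing sequence has a convergent subsequence in the compact
  interval, and lower semicontinuity makes its limit a minimizer.\<close>

lemma minimizers_nonempty:
  assumes iid: "iid_with_law M D \<D>" and nonneg: "AE x in \<D>. 0 \<le> x"
    and int: "integrable \<D> (\<lambda>x. x)" and var: "0 < law_variance \<D>" and p: "0 < p"
  shows "minimizers M D \<D> 1 p \<noteq> {}"
proof -
  define \<mu> where "\<mu> = law_mean \<D>"
  define b where "b r = ennreal (p * \<mu> - p * r)" for r
  define J where "J r = expected_sup M D r + b r" for r
  \<comment> \<open>At \<open>r = \<mu>\<close> the cost is infinite by definition; \<open>J\<close>
    agrees there because the expected supremum diverges.\<close>
  have cost: "cost M D \<D> 1 p r = enn2ereal (J r)" if "r \<in> {0..\<mu>}" for r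
    using that p expected_sup_mean[OF iid int var]
    by (auto simp: cost_def J_def b_def \<mu>_def plus_ennreal.rep_eq one_ereal_def[symmetric] not_less)
  have "0 \<le> \<mu>"
    unfolding \<mu>_def law_mean_def using nonneg by (rule integral_nonneg_AE)
  then have "J ` {0..\<mu>} \<noteq> {}" by simp
  from Inf_as_limit[OF this] obtain u
    where u: "\<And>n. u n \<in> J ` {0..\<mu>}" "u \<longlonglongrightarrow> Inf (J ` {0..\<mu>})" by auto
  from u(1) have "\<forall>n. \<exists>x. x \<in> {0..\<mu>} \<and> u n = J x" by blast
  then obtain r where r: "\<And>n. r n \<in> {0..\<mu>}" "\<And>n. u n = J (r n)"
    by (auto simp: choice_iff)
  have "compact {0..\<mu>}" by simp
  then obtain l s where l: "l \<in> {0..\<mu>}" "strict_mono s" "(r \<circ> s) \<longlonglongrightarrow> l"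
    using r(1) unfolding compact_def by blast
  define c where "c = Inf (J ` {0..\<mu>})"
  have lim_J: "(\<lambda>n. J (r (s n))) \<longlonglongrightarrow> c"
    using LIMSEQ_subseq_LIMSEQ[OF u(2) l(2)] by (simp add: r c_def comp_def)
  have lim_b: "(\<lambda>n. b (r (s n))) \<longlonglongrightarrow> b l"
    unfolding b_def using l(3) by (intro tendsto_intros) (simp add: comp_def)
  have "(\<lambda>n. J (r (s n)) - b (r (s n))) \<longlonglongrightarrow> c - b l"
    by (rule tendsto_diff_ennreal_general[OF lim_J lim_b]) (simp add: b_def)
  then have "liminf (\<lambda>n. expected_sup M D (r (s n))) = c - b l"
    by (intro lim_imp_Liminf) (simp_all add: J_def b_def)
  then have "expected_sup M D l \<le> c - b l"
    using expected_sup_le_liminf[OF iid l(3)] by (simp add: comp_def)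
  \<comment> \<open>Subtraction in \<open>ennreal\<close> is truncated; this inequality allows
    \<open>b l\<close> to be added back.\<close>
  moreover have "b l \<le> c"
    by (rule LIMSEQ_le[OF lim_b lim_J]) (auto simp: J_def)
  ultimately have "J l \<le> c"
    unfolding J_def by (metis add_right_mono diff_add_cancel_ennreal)
  then have "J l \<le> J x" if "x \<in> {0..\<mu>}" for x
    using that unfolding c_def by (meson INF_lower order_trans)
  then have "l \<in> minimizers M D \<D> 1 p"
    using l(1) cost by (auto simp: minimizers_def \<mu>_def[symmetric] less_eq_ennreal.rep_eq)
  then show ?thesis by blast
qed

text \<open>Adding the two optimality inequalities cancels the expected suprema and leaves
  \<open>(q - p) * (r - s) \<le> 0\<close>. The cancellation needs both to be finite.\<close>

lemma minimizers_le:
  assumes iid: "iid_with_law M D \<D>" and nonneg: "AE x in \<D>. 0 \<le> x" and "p < q"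
    and r: "r \<in> minimizers M D \<D> 1 p" and s: "s \<in> minimizers M D \<D> 1 q"
  shows "r \<le> s"
proof (rule ccontr)
  define \<mu> where "\<mu> = law_mean \<D>"
  assume "\<not> r \<le> s"
  with r s have ord: "s < r" "0 \<le> s" "r \<le> \<mu>"
    by (auto simp: minimizers_def \<mu>_def)
  have cost: "cost M D \<D> 1 a x = enn2ereal (expected_sup M D x) + ereal (a * \<mu> - a * x)"
    if "x < \<mu>" for a x
    using that by (simp add: cost_def \<mu>_def one_ereal_def[symmetric])
  \<comment> \<open>Ordering nothing has finite cost, hence so does the minimizer \<open>s\<close>,
    and through it \<open>r\<close>.\<close>
  have "cost M D \<D> 1 q s \<le> cost M D \<D> 1 q 0"
    using s ord by (auto simp: minimizers_def \<mu>_def)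
  also have "\<dots> = ereal (q * \<mu>)"
    using ord by (simp add: cost expected_sup_zero[OF iid nonneg] zero_ennreal.rep_eq)
  finally obtain v where v: "expected_sup M D s = ennreal v" "0 \<le> v"
    using ord by (cases "expected_sup M D s") (auto simp: cost)
  have le: "cost M D \<D> 1 p r \<le> cost M D \<D> 1 p s" "cost M D \<D> 1 q s \<le> cost M D \<D> 1 q r"
    using r s by (auto simp: minimizers_def)
  have "r < \<mu>"
    using le(1) ord v by (auto simp: cost) (auto simp: cost_def \<mu>_def split: if_splits)
  moreover from this obtain w where w: "expected_sup M D r = ennreal w" "0 \<le> w"
    using le(1) ord v by (cases "expected_sup M D r") (auto simp: cost)
  ultimately have "w - p * r \<le> v - p * s" "v - q * s \<le> w - q * r"
    using le ord v by (auto simp: cost)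
  then have "(q - p) * (r - s) \<le> 0" by (simp add: algebra_simps)
  with \<open>p < q\<close> ord show False by (simp add: mult_le_0_iff)
qed

lemma r_inf_mono:
  assumes "iid_with_law M D \<D>" "AE x in \<D>. 0 \<le> x" "integrable \<D> (\<lambda>x. x)" "0 < law_variance \<D>"
    and "0 < p" "p < q"
  shows "r_inf M D \<D> 1 p \<le> r_inf M D \<D> 1 q"
proof -
  obtain r where r: "r \<in> minimizers M D \<D> 1 p"
    \<comment> \<open>Existence matters for both parameters, since \<open>Inf\<close> of an empty
      set of reals would carry no information.\<close>
    using minimizers_nonempty[OF assms(1-5)] by blast
  have bdd: "bdd_below (minimizers M D \<D> 1 p)"
    by (rule bdd_belowI[of _ 0]) (simp add: minimizers_def)
  show ?thesis
    unfolding r_inf_def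
  proof (rule cInf_greatest)
    show "minimizers M D \<D> 1 q \<noteq> {}"
      using minimizers_nonempty[OF assms(1-4)] assms(5,6) by simp
    show "Inf (minimizers M D \<D> 1 p) \<le> s" if "s \<in> minimizers M D \<D> 1 q" for s
      using cInf_lower[OF r bdd] minimizers_le[OF assms(1,2,6) r that] by linarith
  qed
qed

theorem lemma1:
  fixes \<D> :: "real measure"
    and M :: "'a measure"
    and D :: "nat \<Rightarrow> 'a \<Rightarrow> real"
  assumes "iid_with_law M D \<D>"
    and "AE x in \<D>. 0 \<le> x"
    and "integrable \<D> (\<lambda>x. x)"
    and "0 < law_variance \<D>"
  shows "mono_on {0<..} (gamma_ratio M D \<D>)"
proof (rule mono_onI)
  fix p q :: real
  assume "p \<in> {0<..}" "q \<in> {0<..}" "p \<le> q"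
  then have pq: "0 < p" "0 < q" "p = q \<or> p < q" by auto
  have "r_inf M D \<D> 1 p \<le> r_inf M D \<D> 1 q"
    using pq r_inf_mono[OF assms] by auto
  then have "gamma M D \<D> 1 p \<le> gamma M D \<D> 1 q"
    unfolding gamma_def
    \<comment> \<open>The comparison is made for each \<open>\<theta> \<ge> 0\<close> separately;
      \<open>0\<close> bounds the products below, so the real infimum is meaningful.\<close>
    by (intro cINF_mono bdd_belowI2[of _ 0])
       (auto intro!: bexI mult_right_mono mult_left_mono)
  then show "gamma_ratio M D \<D> p \<le> gamma_ratio M D \<D> q"
    using gamma_ratio_eq[of 1 p M D \<D>] gamma_ratio_eq[of 1 q M D \<D>] pq by simp
qed

end
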